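(* Let $\mathsf{X}$ be a category with a topological functor $|\text{-}|\colon\mathsf{X}\to\mathsf{Set}$, and let $\mathbf{1}=L\{*\}$, where $L\colon\mathsf{Set}\to\mathsf{X}$ is the left adjoint of $|\text{-}|$. Assume: (a) $\mathsf{X}$ is pre-order enriched; (b) for all objects $X,Y$ of $\mathsf{X}$, all morphisms $x,x'\colon\mathbf{1}\to X$ and every $|\text{-}|$-initial morphism $f\colon X\to Y$, if $f\cdot x\simeq f\cdot x'$ then $x\simeq x'$; (c) $\mathsf{X}$ has enough injectives: for each object $X$ of $\mathsf{X}$ there is a $|\text{-}|$-initial morphism $y_X\colon X\to\hat X$ with $\hat X$ injective, and if $X$ is separated then so is $\hat X$; (d) every injective object of $\mathsf{X}$ is exponentiable in $\mathsf{X}$; (e) the reflector from $\mathsf{X}$ to its full (reflective) subcategory $\mathsf{X}_{\mathrm{sep}}$ of separated objects preserves finite products. Then the category $\mathsf{X}\text{-}\mathsf{PEqu}$ of partial equilogical objects of $\mathsf{X}$ and the category $\mathsf{Mdst}(\mathsf{X}_{\mathrm{inj}})$ of modest sets over injective objects of $\mathsf{X}$ are equivalent.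
   Context: A functor $|\text{-}|\colon\mathsf{X}\to\mathsf{Set}$ is topological if every (possibly large) $|\text{-}|$-structured source $(A\to|X_i|)_i$ has a unique $|\text{-}|$-initial lifting (in particular it is faithful). A morphism $f\colon X\to Y$ is $|\text{-}|$-initial if for every object $Z$ and every map $h\colon|Z|\to|X|$ such that $|f|\cdot h=|k|$ for some $k\colon Z\to Y$ in $\mathsf{X}$, there is $\bar h\colon Z\to X$ in $\mathsf{X}$ with $|\bar h|=h$. Pre-order enriched: each hom-set $\mathsf{X}(X,Y)$ carries a pre-order $\le$ and composition is monotone; $f\simeq g$ means $f\le g$ and $g\le f$. An object $X$ is separated if for all $f,g\colon Y\to X$, $f\simeq g$ implies $f=g$. The full subcategory $\mathsf{X}_{\mathrm{sep}}$ of separated objects is closed under mono-sources, hence (regular epi-)reflective in $\mathsf{X}$. An object $Z$ is injective (in the pseudo sense) if for each $|\text{-}|$-initial $y\colon X\to Y$ and each $f\colon X\to Z$ there is $\hat f\colon Y\to Z$ with $\hat f\cdot y\simeq f$; $\mathsf{X}_{\mathrm{inj}}$ is the full subcategory of injective objects. An object $X$ is exponentiable if $(-)\times X\colon\mathsf{X}\to\mathsf{X}$ has a right adjoint. $\mathsf{X}\text{-}\mathsf{PEqu}$: objects are pairs $\langle X,\equiv_{|X|}\rangle$ with $X\in\mathsf{X}_{\mathrm{inj}}$ and $\equiv_{|X|}$ a partial equivalence relation (symmetric and transitive, not necessarily reflexive) on $|X|$. A morphism $\langle X,\equiv_{|X|}\rangle\to\langle Y,\equiv_{|Y|}\rangle$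 is an equivalence class $[f]$ of $\mathsf{X}$-morphisms $f\colon X\to Y$ with $|f|$ equivariant ($x\equiv_{|X|}x'$ implies $|f|(x)\equiv_{|Y|}|f|(x')$), where $f,g$ are equivalent iff for all $x,x'\in|X|$, $x\equiv_{|X|}x'$ implies $|f|(x)\equiv_{|Y|}|g|(x')$; composition and identities are induced from $\mathsf{X}$. The category $\mathsf{Assm}(\mathsf{X}_{\mathrm{inj}})$ of assemblies: objects are triples $(A,X,E_A)$ with $A$ a set, $X\in\mathsf{X}_{\mathrm{inj}}$, and $E_A\colon A\to\mathcal{P}|X|$ a function into the powerset of $|X|$ with $E_A(a)\neq\emptyset$ for all $a\in A$. A morphism $(A,X,E_A)\to(B,Y,E_B)$ is a map $f\colon A\to B$ for which there exists a morphism $g\colon X\to Y$ of $\mathsf{X}$ (a realizer for $f$) with $|g|(E_A(a))\subseteq E_B(f(a))$ for all $a\in A$. $\mathsf{Mdst}(\mathsf{X}_{\mathrm{inj}})$ is the full subcategory of $\mathsf{Assm}(\mathsf{X}_{\mathrm{inj}})$ of the modest sets, i.e. those $(A,X,E_A)$ such that $a\neq a'$ implies $E_A(a)\cap E_A(a')=\emptyset$ for all $a,a'\in A$. *)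

theory Defs
  imports "HOL-Library.FuncSet"
begin

section \<open>Categories, functors, adjunctions\<close>

record ('o, 'm) cat =
  Obj :: "'o set"
  Arr :: "'m set"
  Dom :: "'m \<Rightarrow> 'o"
  Cod :: "'m \<Rightarrow> 'o"
  Id :: "'o \<Rightarrow> 'm"
  Comp :: "'m \<Rightarrow> 'm \<Rightarrow> 'm"  (infixr \<open>\<cdot>\<index>\<close> 75)

definition hom :: "('o, 'm) cat \<Rightarrow> 'o \<Rightarrow> 'o \<Rightarrow> 'm set" where
  "hom C A B = {f \<in> Arr C. Dom C f = A \<and> Cod C f = B}"

locale category =
  fixes C :: "('o, 'm) cat" (structure)
  assumes dom_obj: "f \<in> Arr C \<Longrightarrow> Dom C f \<in> Obj C"
    and cod_obj: "f \<in> Arr C \<Longrightarrow> Cod C f \<in> Obj C"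
    and id_hom: "A \<in> Obj C \<Longrightarrow> Id C A \<in> hom C A A"
    and comp_hom: "\<lbrakk>f \<in> hom C A B; g \<in> hom C B D\<rbrakk> \<Longrightarrow> g \<cdot> f \<in> hom C A D"
    and comp_id: "f \<in> hom C A B \<Longrightarrow> f \<cdot> Id C A = f"
    and id_comp: "f \<in> hom C A B \<Longrightarrow> Id C B \<cdot> f = f"
    and comp_assoc: "\<lbrakk>f \<in> hom C A B; g \<in> hom C B D; h \<in> hom C D E\<rbrakk>
      \<Longrightarrow> (h \<cdot> g) \<cdot> f = h \<cdot> (g \<cdot> f)"

definition full_subcategory :: "('o, 'm) cat \<Rightarrow> 'o set \<Rightarrow> ('o, 'm) cat" where
  "full_subcategory C S =
    C\<lparr>Obj := Obj C \<inter> S, Arr := {f \<in> Arr C. Dom C f \<in> S \<and> Cod C f \<in> S}\<rparr>"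

record ('o, 'm, 'p, 'n) fctr =
  FObj :: "'o \<Rightarrow> 'p"
  FArr :: "'m \<Rightarrow> 'n"

definition is_functor ::
  "('o, 'm) cat \<Rightarrow> ('p, 'n) cat \<Rightarrow> ('o, 'm, 'p, 'n) fctr \<Rightarrow> bool" where
  "is_functor C D F \<longleftrightarrow>
    (\<forall>A\<in>Obj C. FObj F A \<in> Obj D) \<and>
    (\<forall>A B. \<forall>f\<in>hom C A B. FArr F f \<in> hom D (FObj F A) (FObj F B)) \<and>
    (\<forall>A\<in>Obj C. FArr F (Id C A) = Id D (FObj F A)) \<and>
    (\<forall>A B E. \<forall>f\<in>hom C A B. \<forall>g\<in>hom C B E.
      FArr F (g \<cdot>\<^bsub>C\<^esub> f) = FArr F g \<cdot>\<^bsub>D\<^esub> FArr F f)"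

definition id_functor :: "('o, 'm, 'o, 'm) fctr" where
  "id_functor = \<lparr>FObj = (\<lambda>A. A), FArr = (\<lambda>f. f)\<rparr>"

definition comp_functor ::
  "('p, 'n, 'q, 'k) fctr \<Rightarrow> ('o, 'm, 'p, 'n) fctr \<Rightarrow> ('o, 'm, 'q, 'k) fctr" where
  "comp_functor G F = \<lparr>FObj = FObj G \<circ> FObj F, FArr = FArr G \<circ> FArr F\<rparr>"

definition faithful :: "('o, 'm) cat \<Rightarrow> ('o, 'm, 'p, 'n) fctr \<Rightarrow> bool" where
  "faithful C F \<longleftrightarrow> (\<forall>A B. inj_on (FArr F) (hom C A B))"

definition is_iso :: "('o, 'm) cat \<Rightarrow> 'm \<Rightarrow> bool" where
  "is_iso C f \<longleftrightarrow> (\<exists>A B. f \<in> hom C A B \<and>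
    (\<exists>g\<in>hom C B A. g \<cdot>\<^bsub>C\<^esub> f = Id C A \<and> f \<cdot>\<^bsub>C\<^esub> g = Id C B))"

definition naturally_isomorphic ::
  "('o, 'm) cat \<Rightarrow> ('p, 'n) cat \<Rightarrow> ('o, 'm, 'p, 'n) fctr \<Rightarrow> ('o, 'm, 'p, 'n) fctr \<Rightarrow> bool" where
  "naturally_isomorphic C D F G \<longleftrightarrow> (\<exists>\<eta> :: 'o \<Rightarrow> 'n.
    (\<forall>A\<in>Obj C. \<eta> A \<in> hom D (FObj F A) (FObj G A) \<and> is_iso D (\<eta> A)) \<and>
    (\<forall>A B. \<forall>f\<in>hom C A B. FArr G f \<cdot>\<^bsub>D\<^esub> \<eta> A = \<eta> B \<cdot>\<^bsub>D\<^esub> FArr F f))"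

definition equivalent_categories :: "('o, 'm) cat \<Rightarrow> ('p, 'n) cat \<Rightarrow> bool" where
  "equivalent_categories C D \<longleftrightarrow> category C \<and> category D \<and>
    (\<exists>F G. is_functor C D F \<and> is_functor D C G \<and>
      naturally_isomorphic C C id_functor (comp_functor G F) \<and>
      naturally_isomorphic D D (comp_functor F G) id_functor)"

definition left_adjoint ::
  "('o, 'm) cat \<Rightarrow> ('p, 'n) cat \<Rightarrow> ('o, 'm, 'p, 'n) fctr \<Rightarrow> ('p, 'n, 'o, 'm) fctr \<Rightarrow> bool" where
  "left_adjoint C D F G \<longleftrightarrow> is_functor C D F \<and> is_functor D C G \<and>
    (\<exists>\<phi> :: 'o \<Rightarrow> 'p \<Rightarrow> 'n \<Rightarrow> 'm.
      (\<forall>A\<in>Obj C. \<forall>B\<in>Obj D. bij_betw (\<phi> A B) (hom D (FObj F A) B) (hom C A (FObj G B))) \<and>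
      (\<forall>A A' B B'. \<forall>f\<in>hom C A' A. \<forall>g\<in>hom D B B'. \<forall>h\<in>hom D (FObj F A) B.
        \<phi> A' B' (g \<cdot>\<^bsub>D\<^esub> h \<cdot>\<^bsub>D\<^esub> FArr F f) = FArr G g \<cdot>\<^bsub>C\<^esub> \<phi> A B h \<cdot>\<^bsub>C\<^esub> f))"

definition is_product ::
  "('o, 'm) cat \<Rightarrow> 'i set \<Rightarrow> ('i \<Rightarrow> 'o) \<Rightarrow> 'o \<Rightarrow> ('i \<Rightarrow> 'm) \<Rightarrow> bool" where
  "is_product C I A P p \<longleftrightarrow> P \<in> Obj C \<and>
    (\<forall>i\<in>I. A i \<in> Obj C \<and> p i \<in> hom C P (A i)) \<and>
    (\<forall>Z\<in>Obj C. \<forall>q. (\<forall>i\<in>I. q i \<in> hom C Z (A i)) \<longrightarrow>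
      (\<exists>!u. u \<in> hom C Z P \<and> (\<forall>i\<in>I. p i \<cdot>\<^bsub>C\<^esub> u = q i)))"

definition preserves_finite_products ::
  "('o, 'm) cat \<Rightarrow> ('p, 'n) cat \<Rightarrow> ('o, 'm, 'p, 'n) fctr \<Rightarrow> bool" where
  "preserves_finite_products C D F \<longleftrightarrow>
    (\<forall>(I :: nat set) A P p. finite I \<longrightarrow> is_product C I A P p \<longrightarrow>
      is_product D I (FObj F \<circ> A) (FObj F P) (FArr F \<circ> p))"

text \<open>\<open>P\<close> is the functor \<open>(-) \<times> X\<close>, for the choice of binary products given by the
  projections \<open>p Y : P Y \<rightarrow> Y\<close> and \<open>q Y : P Y \<rightarrow> X\<close>.\<close>

definition product_functor ::
  "('o, 'm) cat \<Rightarrow> 'o \<Rightarrow> ('o, 'm, 'o, 'm) fctr \<Rightarrow> ('o \<Rightarrow> 'm) \<Rightarrow> ('o \<Rightarrow> 'm) \<Rightarrow> bool" where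
  "product_functor C X P p q \<longleftrightarrow> is_functor C C P \<and>
    (\<forall>Y\<in>Obj C. is_product C UNIV (case_bool Y X) (FObj P Y) (case_bool (p Y) (q Y))) \<and>
    (\<forall>Y Y'. \<forall>f\<in>hom C Y Y'.
      p Y' \<cdot>\<^bsub>C\<^esub> FArr P f = f \<cdot>\<^bsub>C\<^esub> p Y \<and> q Y' \<cdot>\<^bsub>C\<^esub> FArr P f = q Y)"

definition exponentiable :: "('o, 'm) cat \<Rightarrow> 'o \<Rightarrow> bool" where
  "exponentiable C X \<longleftrightarrow> X \<in> Obj C \<and>
    (\<exists>P p q. product_functor C X P p q \<and> (\<exists>G. left_adjoint C C P G))"


section \<open>The category of sets\<close>

text \<open>The type \<open>'u\<close> plays the role of the class of all sets (or of individuals), \<open>'u set\<close> that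
  of its subclasses; \<open>small\<close> singles out those classes that are sets. The closure conditions are
  separation, replacement, union, power set and infinity. If \<open>'u\<close> carries a model of ZFC and
  \<open>small A\<close> says that \<open>A\<close> is the extension of a set, then \<open>SET small\<close> is the usual category of
  sets.\<close>

definition set_universe :: "('u set \<Rightarrow> bool) \<Rightarrow> bool" where
  "set_universe small \<longleftrightarrow>
    (\<forall>A B. small A \<longrightarrow> B \<subseteq> A \<longrightarrow> small B) \<and>
    (\<forall>A (f :: 'u \<Rightarrow> 'u). small A \<longrightarrow> small (f ` A)) \<and>
    (\<forall>I (F :: 'u \<Rightarrow> 'u set). small I \<longrightarrow> (\<forall>i\<in>I. small (F i)) \<longrightarrow> small (\<Union>i\<in>I. F i)) \<and>
    (\<forall>A. small A \<longrightarrow> (\<exists>e :: 'u set \<Rightarrow> 'u. inj_on e (Pow A) \<and> small (e ` Pow A))) \<and>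
    (\<exists>A. small A \<and> infinite A)"

type_synonym 'u setmap = "'u set \<times> ('u \<Rightarrow> 'u) \<times> 'u set"

definition SET :: "('u set \<Rightarrow> bool) \<Rightarrow> ('u set, 'u setmap) cat" where
  "SET small =
    \<lparr>Obj = {A. small A},
     Arr = {(A, f, B). small A \<and> small B \<and> f \<in> A \<rightarrow>\<^sub>E B},
     Dom = (\<lambda>(A, f, B). A),
     Cod = (\<lambda>(A, f, B). B),
     Id = (\<lambda>A. (A, \<lambda>x\<in>A. x, A)),
     Comp = (\<lambda>(_, g, D) (A, f, _). (A, compose A g f, D))\<rparr>"

abbreviation underlying_map :: "('o, 'm, 'u set, 'u setmap) fctr \<Rightarrow> 'm \<Rightarrow> 'u \<Rightarrow> 'u" where
  "underlying_map U f \<equiv> fst (snd (FArr U f))"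


section \<open>Initiality and topological functors\<close>

definition initial_morphism ::
  "('u set \<Rightarrow> bool) \<Rightarrow> ('o, 'm) cat \<Rightarrow> ('o, 'm, 'u set, 'u setmap) fctr \<Rightarrow> 'o \<Rightarrow> 'o \<Rightarrow> 'm \<Rightarrow> bool"
  where
  "initial_morphism small X U A B f \<longleftrightarrow> f \<in> hom X A B \<and>
    (\<forall>Z\<in>Obj X. \<forall>h\<in>hom (SET small) (FObj U Z) (FObj U A).
      (\<exists>k\<in>hom X Z B. FArr U f \<cdot>\<^bsub>SET small\<^esub> h = FArr U k) \<longrightarrow>
      (\<exists>h'\<in>hom X Z A. FArr U h' = h))"

definition initial_source ::
  "('u set \<Rightarrow> bool) \<Rightarrow> ('o, 'm) cat \<Rightarrow> ('o, 'm, 'u set, 'u setmap) fctr \<Rightarrow>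
    'o \<Rightarrow> 'i set \<Rightarrow> ('i \<Rightarrow> 'o) \<Rightarrow> ('i \<Rightarrow> 'm) \<Rightarrow> bool" where
  "initial_source small X U A I B m \<longleftrightarrow> A \<in> Obj X \<and> (\<forall>i\<in>I. m i \<in> hom X A (B i)) \<and>
    (\<forall>Z\<in>Obj X. \<forall>h\<in>hom (SET small) (FObj U Z) (FObj U A).
      (\<forall>i\<in>I. \<exists>k\<in>hom X Z (B i). FArr U (m i) \<cdot>\<^bsub>SET small\<^esub> h = FArr U k) \<longrightarrow>
      (\<exists>h'\<in>hom X Z A. FArr U h' = h))"

definition initial_liftings ::
  "('u set \<Rightarrow> bool) \<Rightarrow> ('o, 'm) cat \<Rightarrow> ('o, 'm, 'u set, 'u setmap) fctr \<Rightarrow>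
    'u set \<Rightarrow> 'i set \<Rightarrow> ('i \<Rightarrow> 'o) \<Rightarrow> ('i \<Rightarrow> 'u setmap) \<Rightarrow> ('o \<times> ('i \<Rightarrow> 'm)) set" where
  "initial_liftings small X U S I B f =
    {(A, m). m \<in> extensional I \<and> initial_source small X U A I B m \<and>
      FObj U A = S \<and> (\<forall>i\<in>I. FArr U (m i) = f i)}"

text \<open>The sources quantified over are indexed by arbitrary sets of pairs of a map and an object.
  This covers all class-indexed sources: for a faithful functor, repeating a member of a source
  does not affect its initial liftings, so a source \<open>(f i : S \<rightarrow> |B i|)\<close> may be indexed by the
  pairs \<open>(f i, B i)\<close>. Faithfulness is a consequence of the lifting property for sources indexed
  by arbitrary classes, repetitions included; here it is part of the definition.\<close>

definition topological ::
  "('u set \<Rightarrow> bool) \<Rightarrow> ('o, 'm) cat \<Rightarrow> ('o, 'm, 'u set, 'u setmap) fctr \<Rightarrow> bool" where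
  "topological small X U \<longleftrightarrow> is_functor X (SET small) U \<and> faithful X U \<and>
    (\<forall>S\<in>Obj (SET small). \<forall>(I :: ('u setmap \<times> 'o) set) B f.
      (\<forall>i\<in>I. B i \<in> Obj X \<and> f i \<in> hom (SET small) S (FObj U (B i))) \<longrightarrow>
      (\<exists>!l. l \<in> initial_liftings small X U S I B f))"


section \<open>Pre-order enrichment, separated and injective objects\<close>

definition preorder_enriched :: "('o, 'm) cat \<Rightarrow> ('m \<Rightarrow> 'm \<Rightarrow> bool) \<Rightarrow> bool" where
  "preorder_enriched X le \<longleftrightarrow>
    (\<forall>A B. reflp_on (hom X A B) le \<and> transp_on (hom X A B) le) \<and>
    (\<forall>A B D. \<forall>f\<in>hom X A B. \<forall>f'\<in>hom X A B. \<forall>g\<in>hom X B D. \<forall>g'\<in>hom X B D.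
      le f f' \<longrightarrow> le g g' \<longrightarrow> le (g \<cdot>\<^bsub>X\<^esub> f) (g' \<cdot>\<^bsub>X\<^esub> f'))"

definition equivalent_under :: "('m \<Rightarrow> 'm \<Rightarrow> bool) \<Rightarrow> 'm \<Rightarrow> 'm \<Rightarrow> bool" where
  "equivalent_under le f g \<longleftrightarrow> le f g \<and> le g f"

definition separated :: "('o, 'm) cat \<Rightarrow> ('m \<Rightarrow> 'm \<Rightarrow> bool) \<Rightarrow> 'o \<Rightarrow> bool" where
  "separated X le A \<longleftrightarrow> A \<in> Obj X \<and>
    (\<forall>Y. \<forall>f\<in>hom X Y A. \<forall>g\<in>hom X Y A. equivalent_under le f g \<longrightarrow> f = g)"

definition X_sep :: "('o, 'm) cat \<Rightarrow> ('m \<Rightarrow> 'm \<Rightarrow> bool) \<Rightarrow> ('o, 'm) cat" where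
  "X_sep X le = full_subcategory X {A. separated X le A}"

definition injective ::
  "('u set \<Rightarrow> bool) \<Rightarrow> ('o, 'm) cat \<Rightarrow> ('m \<Rightarrow> 'm \<Rightarrow> bool) \<Rightarrow>
    ('o, 'm, 'u set, 'u setmap) fctr \<Rightarrow> 'o \<Rightarrow> bool" where
  "injective small X le U Z \<longleftrightarrow> Z \<in> Obj X \<and>
    (\<forall>A B y. initial_morphism small X U A B y \<longrightarrow>
      (\<forall>f\<in>hom X A Z. \<exists>f'\<in>hom X B Z. equivalent_under le (f' \<cdot>\<^bsub>X\<^esub> y) f))"

definition X_inj ::
  "('u set \<Rightarrow> bool) \<Rightarrow> ('o, 'm) cat \<Rightarrow> ('m \<Rightarrow> 'm \<Rightarrow> bool) \<Rightarrow>
    ('o, 'm, 'u set, 'u setmap) fctr \<Rightarrow> ('o, 'm) cat" where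
  "X_inj small X le U = full_subcategory X {Z. injective small X le U Z}"

definition enough_injectives ::
  "('u set \<Rightarrow> bool) \<Rightarrow> ('o, 'm) cat \<Rightarrow> ('m \<Rightarrow> 'm \<Rightarrow> bool) \<Rightarrow>
    ('o, 'm, 'u set, 'u setmap) fctr \<Rightarrow> bool" where
  "enough_injectives small X le U \<longleftrightarrow>
    (\<forall>A\<in>Obj X. \<exists>B y. initial_morphism small X U A B y \<and> injective small X le U B \<and>
      (separated X le A \<longrightarrow> separated X le B))"


section \<open>Partial equilogical objects\<close>

type_synonym ('o, 'u) pequ_obj = "'o \<times> 'u rel"

definition equivariant ::
  "('o, 'm) cat \<Rightarrow> ('o, 'm, 'u set, 'u setmap) fctr \<Rightarrow>
    ('o, 'u) pequ_obj \<Rightarrow> ('o, 'u) pequ_obj \<Rightarrow> 'm set" where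
  "equivariant X U = (\<lambda>(A, r) (B, s).
    {f \<in> hom X A B. \<forall>(x, x')\<in>r. (underlying_map U f x, underlying_map U f x') \<in> s})"

definition pequ_rel ::
  "('o, 'm) cat \<Rightarrow> ('o, 'm, 'u set, 'u setmap) fctr \<Rightarrow>
    ('o, 'u) pequ_obj \<Rightarrow> ('o, 'u) pequ_obj \<Rightarrow> 'm rel" where
  "pequ_rel X U P Q =
    {(f, g). f \<in> equivariant X U P Q \<and> g \<in> equivariant X U P Q \<and>
      (\<forall>(x, x')\<in>snd P. (underlying_map U f x, underlying_map U g x') \<in> snd Q)}"

definition PEqu ::
  "('u set \<Rightarrow> bool) \<Rightarrow> ('o, 'm) cat \<Rightarrow> ('m \<Rightarrow> 'm \<Rightarrow> bool) \<Rightarrow>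
    ('o, 'm, 'u set, 'u setmap) fctr \<Rightarrow>
    (('o, 'u) pequ_obj, ('o, 'u) pequ_obj \<times> 'm set \<times> ('o, 'u) pequ_obj) cat" where
  "PEqu small X le U =
    (let Ob = {(A, r). A \<in> Obj (X_inj small X le U) \<and>
                r \<subseteq> FObj U A \<times> FObj U A \<and> sym r \<and> trans r}
     in \<lparr>Obj = Ob,
         Arr = {(P, c, Q). P \<in> Ob \<and> Q \<in> Ob \<and> c \<in> equivariant X U P Q // pequ_rel X U P Q},
         Dom = (\<lambda>(P, c, Q). P),
         Cod = (\<lambda>(P, c, Q). Q),
         Id = (\<lambda>P. (P, pequ_rel X U P P `` {Id X (fst P)}, P)),
         Comp = (\<lambda>(_, d, R) (P, c, _).
           (P, pequ_rel X U P R `` {g \<cdot>\<^bsub>X\<^esub> f | f g. f \<in> c \<and> g \<in> d}, R))\<rparr>)"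


section \<open>Assemblies and modest sets\<close>

type_synonym ('o, 'u) assembly = "'u set \<times> 'o \<times> ('u \<Rightarrow> 'u set)"

definition Assm ::
  "('u set \<Rightarrow> bool) \<Rightarrow> ('o, 'm) cat \<Rightarrow> ('m \<Rightarrow> 'm \<Rightarrow> bool) \<Rightarrow>
    ('o, 'm, 'u set, 'u setmap) fctr \<Rightarrow>
    (('o, 'u) assembly, ('o, 'u) assembly \<times> ('u \<Rightarrow> 'u) \<times> ('o, 'u) assembly) cat" where
  "Assm small X le U =
    (let Ob = {(A, Y, E). A \<in> Obj (SET small) \<and> Y \<in> Obj (X_inj small X le U) \<and>
                E \<in> A \<rightarrow>\<^sub>E Pow (FObj U Y) \<and> (\<forall>a\<in>A. E a \<noteq> {})}
     in \<lparr>Obj = Ob,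
         Arr = {((A, Y, E), f, (B, Z, E')).
           (A, Y, E) \<in> Ob \<and> (B, Z, E') \<in> Ob \<and> f \<in> A \<rightarrow>\<^sub>E B \<and>
           (\<exists>g\<in>hom X Y Z. \<forall>a\<in>A. underlying_map U g ` E a \<subseteq> E' (f a))},
         Dom = (\<lambda>(P, f, Q). P),
         Cod = (\<lambda>(P, f, Q). Q),
         Id = (\<lambda>P. (P, \<lambda>a\<in>fst P. a, P)),
         Comp = (\<lambda>(_, g, R) (P, f, _). (P, compose (fst P) g f, R))\<rparr>)"

definition modest :: "('o, 'u) assembly \<Rightarrow> bool" where
  "modest = (\<lambda>(A, Y, E). \<forall>a\<in>A. \<forall>a'\<in>A. a \<noteq> a' \<longrightarrow> E a \<inter> E a' = {})"

definition Mdst ::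
  "('u set \<Rightarrow> bool) \<Rightarrow> ('o, 'm) cat \<Rightarrow> ('m \<Rightarrow> 'm \<Rightarrow> bool) \<Rightarrow>
    ('o, 'm, 'u set, 'u setmap) fctr \<Rightarrow>
    (('o, 'u) assembly, ('o, 'u) assembly \<times> ('u \<Rightarrow> 'u) \<times> ('o, 'u) assembly) cat" where
  "Mdst small X le U = full_subcategory (Assm small X le U) {P. modest P}"

end

theory Submission
  imports Defs
begin

text \<open>Both categories describe quotients of subsets of \<open>|Y|\<close>, for \<open>Y\<close> injective. A modest set
  \<open>(A, Y, E)\<close> is a family of disjoint nonempty subsets of \<open>|Y|\<close>; such a family is the same
  thing as a partial equivalence relation on \<open>|Y|\<close> (two points are related when they realize
  the same element), together with a set \<open>A\<close> that names the classes.

  Under this correspondence a morphism \<open>Y \<rightarrow> Z\<close> is equivariant iff it realizes some map of names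
  (\<open>realizes_equivariant\<close>, \<open>equivariant_realizes\<close>), the realizers of one map form exactly one class of equivariant
  morphisms (\<open>realizer_set_eq_class\<close>), and a morphism realizes at most one map
  (\<open>realizes_unique\<close>). Sending a map to the set of all its realizers is therefore a fully
  faithful functor from modest sets to partial equilogical objects; it needs no choice of
  realizer. It is surjective on objects: as names of the classes of a given relation take
  representatives, which form a small set because they lie in \<open>|Y|\<close>. A fully faithful and
  essentially surjective functor is an equivalence.\<close>


section \<open>Fully faithful, essentially surjective functors\<close>

lemma hom_objs:
  assumes "category C" "f \<in> hom C A B"
  shows "A \<in> Obj C" "B \<in> Obj C"
  using assms category.dom_obj category.cod_obj by (fastforce simp: hom_def)+

lemma homD: "f \<in> hom C A B \<Longrightarrow> Dom C f = A" "f \<in> hom C A B \<Longrightarrow> Cod C f = B"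
  by (auto simp: hom_def)

lemma is_isoI:
  assumes "f \<in> hom C A B" "g \<in> hom C B A"
    and "g \<cdot>\<^bsub>C\<^esub> f = Id C A" "f \<cdot>\<^bsub>C\<^esub> g = Id C B"
  shows "is_iso C f"
  using assms unfolding is_iso_def by blast

lemma is_iso_inverse:
  assumes "is_iso C f" "f \<in> hom C A B"
  obtains g where "g \<in> hom C B A" "g \<cdot>\<^bsub>C\<^esub> f = Id C A" "f \<cdot>\<^bsub>C\<^esub> g = Id C B"
  using assms by (auto simp: is_iso_def hom_def)

text \<open>The quasi-inverse \<open>F\<close> is obtained by choosing isomorphisms \<open>i P : P \<rightarrow> G (S P)\<close>,
  conjugating with them, and lifting along the fully faithful \<open>G\<close>. The unit is \<open>i\<close> itself, and
  the counit is the lift of the inverse of \<open>i\<close>.\<close>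

lemma fully_faithful_ess_surj_equivalence:
  fixes C :: "('o, 'm) cat" and D :: "('p, 'n) cat"
  assumes C: "category C" and D: "category D" and G: "is_functor D C G"
    and ff: "\<And>A B. \<lbrakk>A \<in> Obj D; B \<in> Obj D\<rbrakk>
      \<Longrightarrow> bij_betw (FArr G) (hom D A B) (hom C (FObj G A) (FObj G B))"
    and ess_surj: "\<And>P. P \<in> Obj C \<Longrightarrow> \<exists>A\<in>Obj D. \<exists>i\<in>hom C P (FObj G A). is_iso C i"
  shows "equivalent_categories C D"
proof -
  interpret C: category C by (rule C)
  interpret D: category D by (rule D)
  have GO: "FObj G A \<in> Obj C" if "A \<in> Obj D" for A
    using G that by (simp add: is_functor_def)
  have GA: "FArr G f \<in> hom C (FObj G A) (FObj G B)" if "f \<in> hom D A B" for f A B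
    using G that by (auto simp: is_functor_def)
  have GI: "FArr G (Id D A) = Id C (FObj G A)" if "A \<in> Obj D" for A
    using G that by (simp add: is_functor_def)
  have GC: "FArr G (g \<cdot>\<^bsub>D\<^esub> f) = FArr G g \<cdot>\<^bsub>C\<^esub> FArr G f"
    if "f \<in> hom D A B" "g \<in> hom D B E" for f g A B E
    using G that by (auto simp: is_functor_def)
  have inj: "f = g" if "f \<in> hom D A B" "g \<in> hom D A B" "FArr G f = FArr G g" for f g A B
    using ff[of A B] hom_objs[OF D that(1)] that
    by (auto simp: bij_betw_def inj_on_def)
  obtain S i where S: "\<And>P. P \<in> Obj C \<Longrightarrow> S P \<in> Obj D"
    and i: "\<And>P. P \<in> Obj C \<Longrightarrow> i P \<in> hom C P (FObj G (S P))"
    and iso: "\<And>P. P \<in> Obj C \<Longrightarrow> is_iso C (i P)"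
    using ess_surj by metis
  have "\<exists>j. j \<in> hom C (FObj G (S P)) P \<and> j \<cdot>\<^bsub>C\<^esub> i P = Id C P \<and>
      i P \<cdot>\<^bsub>C\<^esub> j = Id C (FObj G (S P))" if "P \<in> Obj C" for P
    using is_iso_inverse[OF iso i] that by metis
  then obtain j where j: "\<And>P. P \<in> Obj C \<Longrightarrow> j P \<in> hom C (FObj G (S P)) P"
    and ji: "\<And>P. P \<in> Obj C \<Longrightarrow> j P \<cdot>\<^bsub>C\<^esub> i P = Id C P"
    and ij: "\<And>P. P \<in> Obj C \<Longrightarrow> i P \<cdot>\<^bsub>C\<^esub> j P = Id C (FObj G (S P))"
    by metis
  define lift where "lift A B h = inv_into (hom D A B) (FArr G) h" for A B h
  have lift: "lift A B h \<in> hom D A B" "FArr G (lift A B h) = h"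
    if "A \<in> Obj D" "B \<in> Obj D" "h \<in> hom C (FObj G A) (FObj G B)" for A B h
    using ff[OF that(1,2)] that(3) unfolding lift_def
    by (auto simp: bij_betw_def intro: inv_into_into f_inv_into_f)
  define conj where "conj f = i (Cod C f) \<cdot>\<^bsub>C\<^esub> f \<cdot>\<^bsub>C\<^esub> j (Dom C f)" for f
  have conj_hom: "conj f \<in> hom C (FObj G (S P)) (FObj G (S Q))"
    and conj_i: "conj f \<cdot>\<^bsub>C\<^esub> i P = i Q \<cdot>\<^bsub>C\<^esub> f"
    and conj_j: "j Q \<cdot>\<^bsub>C\<^esub> conj f = f \<cdot>\<^bsub>C\<^esub> j P"
    if f: "f \<in> hom C P Q" for f P Q
  proof -
    note PQ = hom_objs[OF C f]
    have eq: "conj f = i Q \<cdot>\<^bsub>C\<^esub> f \<cdot>\<^bsub>C\<^esub> j P"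
      using f by (simp add: conj_def homD)
    have fj: "f \<cdot>\<^bsub>C\<^esub> j P \<in> hom C (FObj G (S P)) Q"
      using C.comp_hom j PQ f by blast
    show "conj f \<in> hom C (FObj G (S P)) (FObj G (S Q))"
      unfolding eq using C.comp_hom fj i PQ by blast
    have "conj f \<cdot>\<^bsub>C\<^esub> i P = i Q \<cdot>\<^bsub>C\<^esub> (f \<cdot>\<^bsub>C\<^esub> j P) \<cdot>\<^bsub>C\<^esub> i P"
      unfolding eq by (rule C.comp_assoc[OF i[OF PQ(1)] fj i[OF PQ(2)]])
    also have "(f \<cdot>\<^bsub>C\<^esub> j P) \<cdot>\<^bsub>C\<^esub> i P = f"
      using C.comp_assoc[OF i[OF PQ(1)] j[OF PQ(1)] f] ji[OF PQ(1)] C.comp_id[OF f] by simp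
    finally show "conj f \<cdot>\<^bsub>C\<^esub> i P = i Q \<cdot>\<^bsub>C\<^esub> f" .
    show "j Q \<cdot>\<^bsub>C\<^esub> conj f = f \<cdot>\<^bsub>C\<^esub> j P"
      using C.comp_assoc[OF fj i[OF PQ(2)] j[OF PQ(2)]] ji[OF PQ(2)] C.id_comp[OF fj]
      by (simp add: eq)
  qed
  define F where "F = \<lparr>FObj = S, FArr = (\<lambda>f. lift (S (Dom C f)) (S (Cod C f)) (conj f))\<rparr>"
  have FObj_F: "FObj F = S" by (simp add: F_def)
  have F: "FArr F f \<in> hom D (S P) (S Q)" "FArr G (FArr F f) = conj f"
    if f: "f \<in> hom C P Q" for f P Q
    using lift[OF S S conj_hom] hom_objs[OF C f] f by (simp_all add: F_def homD)
  have "is_functor C D F"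
    unfolding is_functor_def
  proof (intro conjI allI ballI)
    show "FObj F P \<in> Obj D" if "P \<in> Obj C" for P
      using S that by (simp add: F_def)
    show "FArr F f \<in> hom D (FObj F P) (FObj F Q)" if "f \<in> hom C P Q" for f P Q
      using F[OF that] by (simp add: F_def)
    show "FArr F (Id C P) = Id D (FObj F P)" if P: "P \<in> Obj C" for P
    proof (rule inj)
      note IP = C.id_hom[OF P]
      show "FArr F (Id C P) \<in> hom D (S P) (S P)" by (rule F[OF IP])
      show "Id D (FObj F P) \<in> hom D (S P) (S P)" using D.id_hom S P by (simp add: F_def)
      have "conj (Id C P) = Id C (FObj G (S P))"
        using C.id_comp[OF j[OF P]] ij[OF P] IP by (simp add: conj_def homD)
      then show "FArr G (FArr F (Id C P)) = FArr G (Id D (FObj F P))"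
        using F(2)[OF IP] GI[OF S[OF P]] by (simp add: F_def)
    qed
    show "FArr F (g \<cdot>\<^bsub>C\<^esub> f) = FArr F g \<cdot>\<^bsub>D\<^esub> FArr F f"
      if f: "f \<in> hom C P Q" and g: "g \<in> hom C Q R" for f g P Q R
    proof (rule inj)
      note gf = C.comp_hom[OF f g] and PQ = hom_objs[OF C f] and R = hom_objs(2)[OF C g]
      show "FArr F (g \<cdot>\<^bsub>C\<^esub> f) \<in> hom D (S P) (S R)" by (rule F[OF gf])
      show "FArr F g \<cdot>\<^bsub>D\<^esub> FArr F f \<in> hom D (S P) (S R)"
        by (rule D.comp_hom[OF F(1)[OF f] F(1)[OF g]])
      have fj: "f \<cdot>\<^bsub>C\<^esub> j P \<in> hom C (FObj G (S P)) Q" using C.comp_hom j PQ f by blast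
      have "conj g \<cdot>\<^bsub>C\<^esub> conj f = (conj g \<cdot>\<^bsub>C\<^esub> i Q) \<cdot>\<^bsub>C\<^esub> f \<cdot>\<^bsub>C\<^esub> j P"
        using C.comp_assoc[OF fj i[OF PQ(2)] conj_hom[OF g]] f by (simp add: conj_def homD)
      also have "\<dots> = i R \<cdot>\<^bsub>C\<^esub> g \<cdot>\<^bsub>C\<^esub> f \<cdot>\<^bsub>C\<^esub> j P"
        using C.comp_assoc[OF fj g i[OF R]] conj_i[OF g] by simp
      also have "\<dots> = conj (g \<cdot>\<^bsub>C\<^esub> f)"
        using C.comp_assoc[OF j[OF PQ(1)] f g] gf by (simp add: conj_def homD)
      finally show "FArr G (FArr F (g \<cdot>\<^bsub>C\<^esub> f)) = FArr G (FArr F g \<cdot>\<^bsub>D\<^esub> FArr F f)"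
        using F(2)[OF gf] F(2)[OF f] F(2)[OF g] GC[OF F(1)[OF f] F(1)[OF g]] by simp
    qed
  qed
  moreover have "naturally_isomorphic C C id_functor (comp_functor G F)"
    unfolding naturally_isomorphic_def
    by (rule exI[of _ i]) (auto simp: id_functor_def comp_functor_def FObj_F
        i iso F(2) conj_i)
  moreover have "naturally_isomorphic D D (comp_functor F G) id_functor"
  proof -
    define \<epsilon> where "\<epsilon> A = lift (S (FObj G A)) A (j (FObj G A))" for A
    have \<epsilon>: "\<epsilon> A \<in> hom D (S (FObj G A)) A" "FArr G (\<epsilon> A) = j (FObj G A)" if "A \<in> Obj D" for A
      using lift[OF S[OF GO[OF that]] that j[OF GO[OF that]]] by (simp_all add: \<epsilon>_def)
    have "is_iso D (\<epsilon> A)" if A: "A \<in> Obj D" for A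
    proof (rule is_isoI)
      note GA = GO[OF A]
      define k where "k = lift A (S (FObj G A)) (i (FObj G A))"
      have k: "k \<in> hom D A (S (FObj G A))" "FArr G k = i (FObj G A)"
        using lift[OF A S[OF GA] i[OF GA]] by (simp_all add: k_def)
      show "\<epsilon> A \<in> hom D (S (FObj G A)) A" by (rule \<epsilon>[OF A])
      show "k \<in> hom D A (S (FObj G A))" by (rule k)
      show "k \<cdot>\<^bsub>D\<^esub> \<epsilon> A = Id D (S (FObj G A))"
        by (rule inj[OF D.comp_hom[OF \<epsilon>(1)[OF A] k(1)] D.id_hom[OF S[OF GA]]])
          (simp add: GC[OF \<epsilon>(1)[OF A] k(1)] \<epsilon>(2)[OF A] k(2) ij[OF GA] GI[OF S[OF GA]])
      show "\<epsilon> A \<cdot>\<^bsub>D\<^esub> k = Id D A"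
        by (rule inj[OF D.comp_hom[OF k(1) \<epsilon>(1)[OF A]] D.id_hom[OF A]])
          (simp add: GC[OF k(1) \<epsilon>(1)[OF A]] \<epsilon>(2)[OF A] k(2) ji[OF GA] GI[OF A])
    qed
    moreover have "f \<cdot>\<^bsub>D\<^esub> \<epsilon> A = \<epsilon> B \<cdot>\<^bsub>D\<^esub> FArr F (FArr G f)" if f: "f \<in> hom D A B" for f A B
    proof (rule inj)
      note AB = hom_objs[OF D f] and Gf = GA[OF f]
      show "f \<cdot>\<^bsub>D\<^esub> \<epsilon> A \<in> hom D (S (FObj G A)) B"
        by (rule D.comp_hom[OF \<epsilon>(1)[OF AB(1)] f])
      show "\<epsilon> B \<cdot>\<^bsub>D\<^esub> FArr F (FArr G f) \<in> hom D (S (FObj G A)) B"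
        by (rule D.comp_hom[OF F(1)[OF Gf] \<epsilon>(1)[OF AB(2)]])
      show "FArr G (f \<cdot>\<^bsub>D\<^esub> \<epsilon> A) = FArr G (\<epsilon> B \<cdot>\<^bsub>D\<^esub> FArr F (FArr G f))"
        by (simp add: GC[OF \<epsilon>(1)[OF AB(1)] f] GC[OF F(1)[OF Gf] \<epsilon>(1)[OF AB(2)]] \<epsilon>(2) AB
            F(2)[OF Gf] conj_j[OF Gf])
    qed
    ultimately show ?thesis
      unfolding naturally_isomorphic_def
      by (intro exI[of _ \<epsilon>])
        (auto simp: id_functor_def comp_functor_def FObj_F \<epsilon>)
  qed
  ultimately show ?thesis
    unfolding equivalent_categories_def using C D G by blast
qed


section \<open>The two categories\<close>

lemma hom_full_subcategory:
  "hom (full_subcategory C S) A B = {f \<in> hom C A B. A \<in> S \<and> B \<in> S}"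
  by (auto simp: hom_def full_subcategory_def)

lemma category_full_subcategory:
  assumes "category C"
  shows "category (full_subcategory C S)"
proof -
  interpret category C by (rule assms)
  show ?thesis
  proof
    show "Dom (full_subcategory C S) f \<in> Obj (full_subcategory C S)"
      "Cod (full_subcategory C S) f \<in> Obj (full_subcategory C S)"
      if "f \<in> Arr (full_subcategory C S)" for f
      using that dom_obj cod_obj by (auto simp: full_subcategory_def)
  qed (unfold hom_full_subcategory,
      auto simp: full_subcategory_def intro: id_hom comp_hom comp_id id_comp comp_assoc)
qed

locale concrete_category = category X
  for X :: "('o, 'm) cat" and small :: "'u set \<Rightarrow> bool"
    and U :: "('o, 'm, 'u set, 'u setmap) fctr" +
  assumes functor_U: "is_functor X (SET small) U"
begin

lemma small_FObj: "A \<in> Obj X \<Longrightarrow> small (FObj U A)"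
  using functor_U by (auto simp: is_functor_def SET_def)

lemma FArr_triple:
  assumes "f \<in> hom X A B"
  shows "FArr U f = (FObj U A, underlying_map U f, FObj U B)"
proof -
  have "FArr U f \<in> hom (SET small) (FObj U A) (FObj U B)"
    using functor_U assms by (auto simp: is_functor_def)
  then show ?thesis
    by (auto simp: hom_def SET_def)
qed

lemma underlying_map_Id:
  assumes "A \<in> Obj X" "x \<in> FObj U A"
  shows "underlying_map U (Id X A) x = x"
  using functor_U assms by (simp add: is_functor_def SET_def)

lemma underlying_map_comp:
  assumes "f \<in> hom X A B" "g \<in> hom X B D" "x \<in> FObj U A"
  shows "underlying_map U (g \<cdot>\<^bsub>X\<^esub> f) x = underlying_map U g (underlying_map U f x)"
proof -
  have "FArr U (g \<cdot>\<^bsub>X\<^esub> f) = FArr U g \<cdot>\<^bsub>SET small\<^esub> FArr U f"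
    using functor_U assms by (auto simp: is_functor_def)
  then show ?thesis
    using assms(3) by (subst (asm) FArr_triple[OF assms(1)], subst (asm) FArr_triple[OF assms(2)])
      (simp add: SET_def compose_def)
qed

definition is_per :: "('o, 'u) pequ_obj \<Rightarrow> bool" where
  "is_per P \<longleftrightarrow> fst P \<in> Obj X \<and> snd P \<subseteq> FObj U (fst P) \<times> FObj U (fst P) \<and>
    sym (snd P) \<and> trans (snd P)"

lemma is_perI:
  "\<lbrakk>A \<in> Obj X; r \<subseteq> FObj U A \<times> FObj U A; sym r; trans r\<rbrakk> \<Longrightarrow> is_per (A, r)"
  by (simp add: is_per_def)

lemma equivariantD:
  assumes "f \<in> equivariant X U P Q"
  shows "f \<in> hom X (fst P) (fst Q)"
    and "(x, x') \<in> snd P \<Longrightarrow> (underlying_map U f x, underlying_map U f x') \<in> snd Q"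
  using assms by (auto simp: equivariant_def split: prod.splits)

lemma equivariantI:
  assumes "f \<in> hom X (fst P) (fst Q)"
    and "\<And>x x'. (x, x') \<in> snd P \<Longrightarrow> (underlying_map U f x, underlying_map U f x') \<in> snd Q"
  shows "f \<in> equivariant X U P Q"
  using assms by (auto simp: equivariant_def split: prod.splits)

lemma pequ_rel_iff:
  "(f, g) \<in> pequ_rel X U P Q \<longleftrightarrow> f \<in> equivariant X U P Q \<and> g \<in> equivariant X U P Q \<and>
    (\<forall>x x'. (x, x') \<in> snd P \<longrightarrow> (underlying_map U f x, underlying_map U g x') \<in> snd Q)"
  by (auto simp: pequ_rel_def)

lemma equiv_pequ_rel:
  assumes P: "is_per P" and Q: "is_per Q"
  shows "equiv (equivariant X U P Q) (pequ_rel X U P Q)"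
proof (rule equivI)
  have sP: "sym (snd P)" and tP: "trans (snd P)" and sQ: "sym (snd Q)" and tQ: "trans (snd Q)"
    using assms by (auto simp: is_per_def)
  show "pequ_rel X U P Q \<subseteq> equivariant X U P Q \<times> equivariant X U P Q"
    by (auto simp: pequ_rel_iff)
  show "refl_on (equivariant X U P Q) (pequ_rel X U P Q)"
    by (auto simp: refl_on_def pequ_rel_iff equivariantD(2))
  show "sym (pequ_rel X U P Q)"
    using sP sQ by (auto simp: sym_def pequ_rel_iff)
  show "trans (pequ_rel X U P Q)"
  proof (rule transI)
    fix f g h assume fg: "(f, g) \<in> pequ_rel X U P Q" and gh: "(g, h) \<in> pequ_rel X U P Q"
    have "(underlying_map U f x, underlying_map U h x') \<in> snd Q" if x: "(x, x') \<in> snd P" for x x'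
    proof -
      \<comment> \<open>A point in the domain of a partial equivalence relation is related to itself.\<close>
      have "(x', x') \<in> snd P" using x sP tP by (meson symD transD)
      then show ?thesis using x fg gh tQ by (meson pequ_rel_iff transD)
    qed
    then show "(f, h) \<in> pequ_rel X U P Q" using fg gh by (auto simp: pequ_rel_iff)
  qed
qed

lemma equivariant_Id:
  assumes "is_per P"
  shows "Id X (fst P) \<in> equivariant X U P P"
proof (rule equivariantI)
  show "Id X (fst P) \<in> hom X (fst P) (fst P)" using assms id_hom by (simp add: is_per_def)
  show "(underlying_map U (Id X (fst P)) x, underlying_map U (Id X (fst P)) x') \<in> snd P"
    if "(x, x') \<in> snd P" for x x'
    using that assms underlying_map_Id[of "fst P"] by (auto simp: is_per_def)
qed

lemma pequ_rel_comp:
  assumes P: "is_per P" and f: "(f, f') \<in> pequ_rel X U P Q" and g: "(g, g') \<in> pequ_rel X U Q R"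
  shows "(g \<cdot>\<^bsub>X\<^esub> f, g' \<cdot>\<^bsub>X\<^esub> f') \<in> pequ_rel X U P R"
proof -
  have sub: "x \<in> FObj U (fst P)" "x' \<in> FObj U (fst P)" if "(x, x') \<in> snd P" for x x'
    using that P by (auto simp: is_per_def)
  have *: "(underlying_map U (h \<cdot>\<^bsub>X\<^esub> k) x, underlying_map U (h' \<cdot>\<^bsub>X\<^esub> k') x') \<in> snd R"
    if "(k, k') \<in> pequ_rel X U P Q" "(h, h') \<in> pequ_rel X U Q R" "(x, x') \<in> snd P"
    for k k' h h' x x'
  proof -
    have "k \<in> equivariant X U P Q" "k' \<in> equivariant X U P Q"
      "h \<in> equivariant X U Q R" "h' \<in> equivariant X U Q R"
      using that by (auto simp: pequ_rel_iff)
    note homs = this[THEN equivariantD(1)]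
    show ?thesis
      using that sub[OF that(3)]
      by (simp add: pequ_rel_iff underlying_map_comp[OF homs(1,3)] underlying_map_comp[OF homs(2,4)])
  qed
  have **: "h \<cdot>\<^bsub>X\<^esub> k \<in> equivariant X U P R"
    if "k \<in> equivariant X U P Q" "h \<in> equivariant X U Q R" for k h
  proof (rule equivariantI)
    show "h \<cdot>\<^bsub>X\<^esub> k \<in> hom X (fst P) (fst R)"
      by (rule comp_hom[OF that[THEN equivariantD(1)]])
    show "(underlying_map U (h \<cdot>\<^bsub>X\<^esub> k) x, underlying_map U (h \<cdot>\<^bsub>X\<^esub> k) x') \<in> snd R"
      if "(x, x') \<in> snd P" for x x'
      using *[of k k h h] \<open>k \<in> _\<close> \<open>h \<in> _\<close> that by (simp add: pequ_rel_iff equivariantD(2))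
  qed
  show ?thesis
    using *[OF f g] ** f g by (auto simp: pequ_rel_iff)
qed

text \<open>Composing equivalent morphisms gives equivalent morphisms, so composition of classes can be
  computed on representatives. All laws of the category reduce to those of \<open>X\<close> through this.\<close>

lemma pequ_class_comp:
  assumes P: "is_per P" and Q: "is_per Q" and R: "is_per R"
    and f: "f \<in> equivariant X U P Q" and g: "g \<in> equivariant X U Q R"
  shows "pequ_rel X U P R `` {g' \<cdot>\<^bsub>X\<^esub> f' | f' g'. f' \<in> pequ_rel X U P Q `` {f} \<and>
      g' \<in> pequ_rel X U Q R `` {g}} = pequ_rel X U P R `` {g \<cdot>\<^bsub>X\<^esub> f}" (is "?l = ?r")
proof
  have ff: "(f, f) \<in> pequ_rel X U P Q" and gg: "(g, g) \<in> pequ_rel X U Q R"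
    using f g by (auto simp: pequ_rel_iff equivariantD(2))
  have "trans (pequ_rel X U P R)" using equiv_pequ_rel[OF P R] by (simp add: equiv_def)
  then show "?l \<subseteq> ?r"
    by (auto intro: transD[OF _ pequ_rel_comp[OF P]])
  show "?r \<subseteq> ?l" using ff gg by blast
qed

lemma Obj_PEqu: "P \<in> Obj (PEqu small X le U) \<longleftrightarrow> is_per P \<and> injective small X le U (fst P)"
  by (cases P) (auto simp: PEqu_def Let_def X_inj_def full_subcategory_def is_per_def)

lemma hom_PEqu:
  "hom (PEqu small X le U) P Q = {(P, c, Q) | c. P \<in> Obj (PEqu small X le U) \<and>
    Q \<in> Obj (PEqu small X le U) \<and> c \<in> equivariant X U P Q // pequ_rel X U P Q}"
  by (auto simp: hom_def PEqu_def Let_def)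

lemma hom_PEquE:
  assumes "h \<in> hom (PEqu small X le U) P Q"
  obtains f where "h = (P, pequ_rel X U P Q `` {f}, Q)" "f \<in> equivariant X U P Q"
    "is_per P" "is_per Q" "P \<in> Obj (PEqu small X le U)" "Q \<in> Obj (PEqu small X le U)"
  using assms by (auto simp: hom_PEqu Obj_PEqu elim!: quotientE)

lemma hom_PEquI:
  assumes "f \<in> equivariant X U P Q" "P \<in> Obj (PEqu small X le U)" "Q \<in> Obj (PEqu small X le U)"
  shows "(P, pequ_rel X U P Q `` {f}, Q) \<in> hom (PEqu small X le U) P Q"
  using assms by (auto simp: hom_PEqu intro: quotientI)

lemma Id_PEqu: "Id (PEqu small X le U) P = (P, pequ_rel X U P P `` {Id X (fst P)}, P)"
  by (simp add: PEqu_def Let_def)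

lemma Comp_PEqu:
  assumes "is_per P" "is_per Q" "is_per R"
    and "f \<in> equivariant X U P Q" "g \<in> equivariant X U Q R"
  shows "(Q, pequ_rel X U Q R `` {g}, R) \<cdot>\<^bsub>PEqu small X le U\<^esub> (P, pequ_rel X U P Q `` {f}, Q) =
    (P, pequ_rel X U P R `` {g \<cdot>\<^bsub>X\<^esub> f}, R)"
  by (simp only: PEqu_def Let_def cat.simps prod.case pequ_class_comp[OF assms])

lemma equivariant_comp:
  assumes "is_per P" "f \<in> equivariant X U P Q" "g \<in> equivariant X U Q R"
  shows "g \<cdot>\<^bsub>X\<^esub> f \<in> equivariant X U P R"
proof -
  have "(f, f) \<in> pequ_rel X U P Q" "(g, g) \<in> pequ_rel X U Q R"
    using assms by (auto simp: pequ_rel_iff equivariantD(2))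
  from pequ_rel_comp[OF assms(1) this] show ?thesis by (simp add: pequ_rel_iff)
qed

lemma category_PEqu: "category (PEqu small X le U)" (is "category ?C")
proof
  show "Dom ?C f \<in> Obj ?C" "Cod ?C f \<in> Obj ?C" if "f \<in> Arr ?C" for f
    using that by (auto simp: PEqu_def Let_def)
  show "Id ?C P \<in> hom ?C P P" if "P \<in> Obj ?C" for P
    using hom_PEquI[OF equivariant_Id] that by (simp add: Id_PEqu Obj_PEqu)
next
  fix P Q R f g assume "f \<in> hom ?C P Q" "g \<in> hom ?C Q R"
  then show "g \<cdot>\<^bsub>?C\<^esub> f \<in> hom ?C P R"
    by (elim hom_PEquE) (auto simp: Comp_PEqu intro!: hom_PEquI intro: equivariant_comp)
next
  fix P Q f assume "f \<in> hom ?C P Q"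
  then show "f \<cdot>\<^bsub>?C\<^esub> Id ?C P = f" "Id ?C Q \<cdot>\<^bsub>?C\<^esub> f = f"
    by (elim hom_PEquE, auto simp: Id_PEqu Comp_PEqu equivariant_Id
        comp_id[OF equivariantD(1)] id_comp[OF equivariantD(1)])+
next
  fix P Q R T f g h assume "f \<in> hom ?C P Q" "g \<in> hom ?C Q R" "h \<in> hom ?C R T"
  then show "(h \<cdot>\<^bsub>?C\<^esub> g) \<cdot>\<^bsub>?C\<^esub> f = h \<cdot>\<^bsub>?C\<^esub> g \<cdot>\<^bsub>?C\<^esub> f"
    by (elim hom_PEquE) (auto simp: Comp_PEqu equivariant_comp
        comp_assoc[OF equivariantD(1) equivariantD(1) equivariantD(1)])
qed

definition realizer_set ::
  "('o, 'u) assembly \<Rightarrow> ('o, 'u) assembly \<Rightarrow> ('u \<Rightarrow> 'u) \<Rightarrow> 'm set" where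
  "realizer_set = (\<lambda>(A, Y, E) (B, Z, E') f.
    {g \<in> hom X Y Z. \<forall>a\<in>A. underlying_map U g ` E a \<subseteq> E' (f a)})"

lemma Obj_Assm: "(A, Y, E) \<in> Obj (Assm small X le U) \<longleftrightarrow> small A \<and> Y \<in> Obj X \<and>
    injective small X le U Y \<and> E \<in> A \<rightarrow>\<^sub>E Pow (FObj U Y) \<and> (\<forall>a\<in>A. E a \<noteq> {})"
  by (auto simp: Assm_def Let_def SET_def X_inj_def full_subcategory_def)

lemma hom_Assm:
  "hom (Assm small X le U) P Q = {(P, f, Q) | f. P \<in> Obj (Assm small X le U) \<and>
    Q \<in> Obj (Assm small X le U) \<and> f \<in> fst P \<rightarrow>\<^sub>E fst Q \<and> realizer_set P Q f \<noteq> {}}"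
  by (cases P, cases Q) (auto simp: hom_def Assm_def Let_def realizer_set_def)

lemma Id_Assm: "Id (Assm small X le U) P = (P, \<lambda>a\<in>fst P. a, P)"
  by (simp add: Assm_def Let_def)

lemma Comp_Assm:
  "(Q', g, R) \<cdot>\<^bsub>Assm small X le U\<^esub> (P, f, Q) = (P, compose (fst P) g f, R)"
  by (simp add: Assm_def Let_def)

lemma realizes_Id:
  assumes "P \<in> Obj (Assm small X le U)"
  shows "Id X (fst (snd P)) \<in> realizer_set P P (\<lambda>a\<in>fst P. a)"
proof (cases P)
  case (fields A Y E)
  have "Y \<in> Obj X" "E \<in> A \<rightarrow>\<^sub>E Pow (FObj U Y)"
    using assms by (auto simp: fields Obj_Assm)
  then show ?thesis
    using id_hom[of Y] 
    by (auto simp: fields realizer_set_def PiE_iff underlying_map_Id subset_iff)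
qed

lemma realizes_comp:
  assumes "P \<in> Obj (Assm small X le U)" "f \<in> fst P \<rightarrow>\<^sub>E fst Q"
    and "h \<in> realizer_set P Q f" "k \<in> realizer_set Q R g"
  shows "k \<cdot>\<^bsub>X\<^esub> h \<in> realizer_set P R (compose (fst P) g f)"
proof -
  obtain A Y E where P: "P = (A, Y, E)" by (cases P)
  obtain B Z E' where Q: "Q = (B, Z, E')" by (cases Q)
  obtain D W E'' where R: "R = (D, W, E'')" by (cases R)
  have h: "h \<in> hom X Y Z" "\<And>a x. a \<in> A \<Longrightarrow> x \<in> E a \<Longrightarrow> underlying_map U h x \<in> E' (f a)"
    using assms(3) by (auto simp: P Q realizer_set_def)
  have k: "k \<in> hom X Z W" "\<And>b y. b \<in> B \<Longrightarrow> y \<in> E' b \<Longrightarrow> underlying_map U k y \<in> E'' (g b)"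
    using assms(4) by (auto simp: Q R realizer_set_def)
  have E: "x \<in> FObj U Y" if "a \<in> A" "x \<in> E a" for a x
    using assms(1) that by (auto simp: P Obj_Assm)
  have f: "f a \<in> B" if "a \<in> A" for a using assms(2) that by (auto simp: P Q)
  show ?thesis
    using comp_hom[OF h(1) k(1)] h(2) k(2) f
    by (auto simp: P R realizer_set_def compose_def underlying_map_comp[OF h(1) k(1) E])
qed

lemma category_Assm: "category (Assm small X le U)" (is "category ?C")
proof
  show "Dom ?C f \<in> Obj ?C" "Cod ?C f \<in> Obj ?C" if "f \<in> Arr ?C" for f
    using that by (auto simp: Assm_def Let_def)
  show "Id ?C P \<in> hom ?C P P" if "P \<in> Obj ?C" for P
    using realizes_Id[OF that] that by (auto simp: Id_Assm hom_Assm)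
next
  fix P Q R f g assume "f \<in> hom ?C P Q" "g \<in> hom ?C Q R"
  then obtain f' g' h k where *: "f = (P, f', Q)" "g = (Q, g', R)" "P \<in> Obj ?C" "R \<in> Obj ?C"
    "f' \<in> fst P \<rightarrow>\<^sub>E fst Q" "g' \<in> fst Q \<rightarrow>\<^sub>E fst R" "h \<in> realizer_set P Q f'" "k \<in> realizer_set Q R g'"
    by (auto simp: hom_Assm)
  have "compose (fst P) g' f' \<in> fst P \<rightarrow>\<^sub>E fst R"
    using *(5,6) by (auto simp: compose_def)
  then show "g \<cdot>\<^bsub>?C\<^esub> f \<in> hom ?C P R"
    using realizes_comp[OF *(3,5,7,8)] * by (auto simp: hom_Assm Comp_Assm)
next
  fix P Q f assume "f \<in> hom ?C P Q"
  then obtain f' where *: "f = (P, f', Q)" "f' \<in> fst P \<rightarrow>\<^sub>E fst Q"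
    by (auto simp: hom_Assm)
  show "f \<cdot>\<^bsub>?C\<^esub> Id ?C P = f" "Id ?C Q \<cdot>\<^bsub>?C\<^esub> f = f"
    using *(2) by (auto simp: *(1) Comp_Assm Id_Assm compose_def PiE_iff fun_eq_iff
        extensional_def)
next
  fix P Q R T f g h assume "f \<in> hom ?C P Q" "g \<in> hom ?C Q R" "h \<in> hom ?C R T"
  then obtain f' g' h' where *: "f = (P, f', Q)" "g = (Q, g', R)" "h = (R, h', T)"
    and f': "f' \<in> fst P \<rightarrow>\<^sub>E fst Q"
    by (auto simp: hom_Assm)
  have "f' \<in> fst P \<rightarrow> fst Q" using f' by auto
  then show "(h \<cdot>\<^bsub>?C\<^esub> g) \<cdot>\<^bsub>?C\<^esub> f = h \<cdot>\<^bsub>?C\<^esub> g \<cdot>\<^bsub>?C\<^esub> f"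
    by (simp add: * Comp_Assm compose_assoc)
qed

lemma category_Mdst: "category (Mdst small X le U)"
  unfolding Mdst_def by (rule category_full_subcategory[OF category_Assm])

lemma Obj_Mdst: "P \<in> Obj (Mdst small X le U) \<longleftrightarrow> P \<in> Obj (Assm small X le U) \<and> modest P"
  by (auto simp: Mdst_def full_subcategory_def)

lemma hom_Mdst: "hom (Mdst small X le U) P Q = {(P, f, Q) | f. P \<in> Obj (Mdst small X le U) \<and>
    Q \<in> Obj (Mdst small X le U) \<and> f \<in> fst P \<rightarrow>\<^sub>E fst Q \<and> realizer_set P Q f \<noteq> {}}"
  unfolding Obj_Mdst unfolding Mdst_def hom_full_subcategory hom_Assm by auto

lemma Id_Mdst: "Id (Mdst small X le U) P = (P, \<lambda>a\<in>fst P. a, P)"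
  using Id_Assm by (simp add: Mdst_def full_subcategory_def)

lemma Comp_Mdst:
  "(Q', g, R) \<cdot>\<^bsub>Mdst small X le U\<^esub> (P, f, Q) = (P, compose (fst P) g f, R)"
  using Comp_Assm by (simp add: Mdst_def full_subcategory_def)


section \<open>From modest sets to partial equilogical objects\<close>

definition realizer_per :: "('o, 'u) assembly \<Rightarrow> ('o, 'u) pequ_obj" where
  "realizer_per = (\<lambda>(A, Y, E). (Y, {(x, x'). \<exists>a\<in>A. x \<in> E a \<and> x' \<in> E a}))"

lemma realizer_per_Obj:
  assumes "P \<in> Obj (Mdst small X le U)"
  shows "realizer_per P \<in> Obj (PEqu small X le U)" and "is_per (realizer_per P)"
proof -
  obtain A Y E where P: "P = (A, Y, E)" by (cases P)
  have E: "E a \<subseteq> FObj U Y" if "a \<in> A" for a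
    using assms that by (auto simp: P Obj_Mdst Obj_Assm)
  have m: "a = a'" if "a \<in> A" "a' \<in> A" "x \<in> E a" "x \<in> E a'" for a a' x
    using assms that by (auto simp: P Obj_Mdst modest_def)
  show "is_per (realizer_per P)"
    unfolding P realizer_per_def prod.case
  proof (rule is_perI)
    show "Y \<in> Obj X" using assms by (simp add: P Obj_Mdst Obj_Assm)
    show "{(x, x'). \<exists>a\<in>A. x \<in> E a \<and> x' \<in> E a} \<subseteq> FObj U Y \<times> FObj U Y"
      using E by blast
    show "sym {(x, x'). \<exists>a\<in>A. x \<in> E a \<and> x' \<in> E a}" by (auto simp: sym_def)
    \<comment> \<open>Transitivity is where disjointness of the sets of realizers is needed.\<close>
    show "trans {(x, x'). \<exists>a\<in>A. x \<in> E a \<and> x' \<in> E a}"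
      by (rule transI) (use m in blast)
  qed
  then show "realizer_per P \<in> Obj (PEqu small X le U)"
    using assms by (auto simp: Obj_PEqu P realizer_per_def Obj_Mdst Obj_Assm)
qed

lemma realizes_equivariant:
  assumes "f \<in> fst P \<rightarrow>\<^sub>E fst Q" "g \<in> realizer_set P Q f"
  shows "g \<in> equivariant X U (realizer_per P) (realizer_per Q)"
proof -
  obtain A Y E where P: "P = (A, Y, E)" by (cases P)
  obtain B Z E' where Q: "Q = (B, Z, E')" by (cases Q)
  show ?thesis
    using assms by (fastforce simp: P Q realizer_set_def realizer_per_def equivariant_def PiE_iff)
qed

text \<open>An equivariant \<open>g\<close> sends all realizers of \<open>a\<close> into a single class of the target relation,
  and the name of that class, unique by disjointness, is the value at \<open>a\<close> of the map that \<open>g\<close>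
  realizes.\<close>

lemma equivariant_realizes:
  assumes P: "P \<in> Obj (Mdst small X le U)" and Q: "Q \<in> Obj (Mdst small X le U)"
    and g: "g \<in> equivariant X U (realizer_per P) (realizer_per Q)"
  obtains f where "f \<in> fst P \<rightarrow>\<^sub>E fst Q" "g \<in> realizer_set P Q f"
proof -
  obtain A Y E where P': "P = (A, Y, E)" by (cases P)
  obtain B Z E' where Q': "Q = (B, Z, E')" by (cases Q)
  have ne: "E a \<noteq> {}" if "a \<in> A" for a
    using P that by (auto simp: P' Obj_Mdst Obj_Assm)
  have m: "b = b'" if "b \<in> B" "b' \<in> B" "x \<in> E' b" "x \<in> E' b'" for b b' x
    using Q that by (auto simp: Q' Obj_Mdst modest_def)
  have g_hom: "g \<in> hom X Y Z"
    and g_eqv: "\<And>a x x'. \<lbrakk>a \<in> A; x \<in> E a; x' \<in> E a\<rbrakk>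
      \<Longrightarrow> \<exists>b\<in>B. underlying_map U g x \<in> E' b \<and> underlying_map U g x' \<in> E' b"
    using g by (auto simp: P' Q' equivariant_def realizer_per_def)
  have "\<exists>b\<in>B. underlying_map U g ` E a \<subseteq> E' b" if a: "a \<in> A" for a
  proof -
    obtain x where x: "x \<in> E a" using ne[OF a] by blast
    obtain b where b: "b \<in> B" "underlying_map U g x \<in> E' b" using g_eqv[OF a x x] by blast
    have "underlying_map U g x' \<in> E' b" if "x' \<in> E a" for x'
      using g_eqv[OF a x that] b m by blast
    then show ?thesis using b(1) by blast
  qed
  then obtain f where f: "\<And>a. a \<in> A \<Longrightarrow> f a \<in> B \<and> underlying_map U g ` E a \<subseteq> E' (f a)"
    by metis
  show thesis
  proof (rule that)
    show "restrict f A \<in> fst P \<rightarrow>\<^sub>E fst Q" using f by (simp add: P' Q')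
    show "g \<in> realizer_set P Q (restrict f A)" using f g_hom by (simp add: P' Q' realizer_set_def)
  qed
qed

text \<open>That all realizers of one map are equivalent is immediate. Conversely, if \<open>h\<close> is
  equivalent to a realizer \<open>g\<close> of \<open>f\<close>, then for each realizer \<open>x\<close> of \<open>a\<close> the values of \<open>g\<close> and
  \<open>h\<close> at \<open>x\<close> realize a common element, which can only be \<open>f a\<close> because the sets of realizers in
  \<open>Q\<close> are disjoint.\<close>

lemma realizer_set_eq_class:
  assumes Q: "Q \<in> Obj (Mdst small X le U)"
    and f: "f \<in> fst P \<rightarrow>\<^sub>E fst Q" and g: "g \<in> realizer_set P Q f"
  shows "realizer_set P Q f = pequ_rel X U (realizer_per P) (realizer_per Q) `` {g}"
proof
  obtain A Y E where P': "P = (A, Y, E)" by (cases P)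
  obtain B Z E' where Q': "Q = (B, Z, E')" by (cases Q)
  have m: "b = b'" if "b \<in> B" "b' \<in> B" "x \<in> E' b" "x \<in> E' b'" for b b' x
    using Q that by (auto simp: Q' Obj_Mdst modest_def)
  have fB: "f a \<in> B" if "a \<in> A" for a using f that by (auto simp: P' Q')
  have real: "underlying_map U k x \<in> E' (f a)" if "k \<in> realizer_set P Q f" "a \<in> A" "x \<in> E a" for k a x
    using that by (auto simp: P' Q' realizer_set_def)
  show "realizer_set P Q f \<subseteq> pequ_rel X U (realizer_per P) (realizer_per Q) `` {g}"
  proof
    fix h assume h: "h \<in> realizer_set P Q f"
    have "(underlying_map U g x, underlying_map U h x') \<in> snd (realizer_per Q)"
      if "(x, x') \<in> snd (realizer_per P)" for x x'
      using that real[OF g] real[OF h] fB by (fastforce simp: P' Q' realizer_per_def)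
    then show "h \<in> pequ_rel X U (realizer_per P) (realizer_per Q) `` {g}"
      using realizes_equivariant[OF f g] realizes_equivariant[OF f h] by (simp add: pequ_rel_iff)
  qed
  show "pequ_rel X U (realizer_per P) (realizer_per Q) `` {g} \<subseteq> realizer_set P Q f"
  proof
    fix h assume "h \<in> pequ_rel X U (realizer_per P) (realizer_per Q) `` {g}"
    then have gh: "(g, h) \<in> pequ_rel X U (realizer_per P) (realizer_per Q)" by simp
    have "underlying_map U h x \<in> E' (f a)" if a: "a \<in> A" and x: "x \<in> E a" for a x
    proof -
      have "(x, x) \<in> snd (realizer_per P)" using a x by (auto simp: P' realizer_per_def)
      then obtain b where "b \<in> B" "underlying_map U g x \<in> E' b" "underlying_map U h x \<in> E' b"
        using gh by (force simp: pequ_rel_iff Q' realizer_per_def)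
      then show ?thesis using m fB[OF a] real[OF g a x] by blast
    qed
    moreover have "h \<in> hom X Y Z"
      using gh equivariantD(1) by (fastforce simp: pequ_rel_iff P' Q' realizer_per_def)
    ultimately show "h \<in> realizer_set P Q f" by (auto simp: P' Q' realizer_set_def)
  qed
qed

lemma realizes_unique:
  assumes P: "P \<in> Obj (Mdst small X le U)" and Q: "Q \<in> Obj (Mdst small X le U)"
    and f: "f \<in> fst P \<rightarrow>\<^sub>E fst Q" "g \<in> realizer_set P Q f"
    and f': "f' \<in> fst P \<rightarrow>\<^sub>E fst Q" "g \<in> realizer_set P Q f'"
  shows "f = f'"
proof (rule PiE_ext[OF f(1) f'(1)])
  obtain A Y E where P': "P = (A, Y, E)" by (cases P)
  obtain B Z E' where Q': "Q = (B, Z, E')" by (cases Q)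
  fix a assume "a \<in> fst P"
  then have a: "a \<in> A" by (simp add: P')
  then obtain x where "x \<in> E a" using P by (fastforce simp: P' Obj_Mdst Obj_Assm)
  then have "underlying_map U g x \<in> E' (f a)" "underlying_map U g x \<in> E' (f' a)"
    using f(2) f'(2) a by (fastforce simp: P' Q' realizer_set_def)+
  moreover have "f a \<in> B" "f' a \<in> B" using f(1) f'(1) a by (auto simp: P' Q')
  ultimately show "f a = f' a" using Q by (auto simp: Q' Obj_Mdst modest_def)
qed

definition realizer_functor :: "(('o, 'u) assembly, ('o, 'u) assembly \<times> ('u \<Rightarrow> 'u) \<times> ('o, 'u) assembly,
    ('o, 'u) pequ_obj, ('o, 'u) pequ_obj \<times> 'm set \<times> ('o, 'u) pequ_obj) fctr" where
  "realizer_functor = \<lparr>FObj = realizer_per,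
    FArr = (\<lambda>(P, f, Q). (realizer_per P, realizer_set P Q f, realizer_per Q))\<rparr>"

lemma FObj_realizer_functor: "FObj realizer_functor = realizer_per"
  by (simp add: realizer_functor_def)

lemma is_functor_realizer_functor:
  "is_functor (Mdst small X le U) (PEqu small X le U) realizer_functor"
    (is "is_functor ?M ?C ?G")
  unfolding is_functor_def
proof (intro conjI allI ballI)
  show "FObj ?G P \<in> Obj ?C" if "P \<in> Obj ?M" for P
    using realizer_per_Obj[OF that] by (simp add: realizer_functor_def)
  show "FArr ?G f \<in> hom ?C (FObj ?G P) (FObj ?G Q)" if f: "f \<in> hom ?M P Q" for f P Q
  proof -
    obtain f' g where *: "f = (P, f', Q)" "P \<in> Obj ?M" "Q \<in> Obj ?M" "f' \<in> fst P \<rightarrow>\<^sub>E fst Q"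
      "g \<in> realizer_set P Q f'" using f by (auto simp: hom_Mdst)
    show ?thesis
      using hom_PEquI[OF realizes_equivariant[OF *(4,5)] realizer_per_Obj(1)[OF *(2)]
          realizer_per_Obj(1)[OF *(3)]] realizer_set_eq_class[OF *(3,4,5)]
      by (simp add: *(1) realizer_functor_def)
  qed
  show "FArr ?G (Id ?M P) = Id ?C (FObj ?G P)" if P: "P \<in> Obj ?M" for P
  proof -
    have "P \<in> Obj (Assm small X le U)" using P by (simp add: Obj_Mdst)
    then have "realizer_set P P (\<lambda>a\<in>fst P. a) =
        pequ_rel X U (realizer_per P) (realizer_per P) `` {Id X (fst (snd P))}"
      using realizer_set_eq_class[OF P _ realizes_Id] by simp
    moreover have "fst (snd P) = fst (realizer_per P)"
      by (simp add: realizer_per_def split: prod.splits)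
    ultimately show ?thesis
      by (simp add: Id_Mdst Id_PEqu realizer_functor_def)
  qed
  show "FArr ?G (g \<cdot>\<^bsub>?M\<^esub> f) = FArr ?G g \<cdot>\<^bsub>?C\<^esub> FArr ?G f"
    if f: "f \<in> hom ?M P Q" and g: "g \<in> hom ?M Q R" for f g P Q R
  proof -
    obtain f' h where *: "f = (P, f', Q)" "P \<in> Obj ?M" "Q \<in> Obj ?M" "f' \<in> fst P \<rightarrow>\<^sub>E fst Q"
      "h \<in> realizer_set P Q f'" using f by (auto simp: hom_Mdst)
    obtain g' k where **: "g = (Q, g', R)" "R \<in> Obj ?M" "g' \<in> fst Q \<rightarrow>\<^sub>E fst R"
      "k \<in> realizer_set Q R g'" using g by (auto simp: hom_Mdst)
    have "P \<in> Obj (Assm small X le U)" using *(2) by (simp add: Obj_Mdst)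
    then have kh: "k \<cdot>\<^bsub>X\<^esub> h \<in> realizer_set P R (compose (fst P) g' f')"
      using realizes_comp *(4,5) **(4) by blast
    have "compose (fst P) g' f' \<in> fst P \<rightarrow>\<^sub>E fst R"
      using *(4) **(3) by (auto simp: compose_def)
    then show ?thesis
      using realizer_set_eq_class[OF *(3,4,5)] realizer_set_eq_class[OF **(2,3,4)]
        realizer_set_eq_class[OF **(2) _ kh]
        Comp_PEqu[OF realizer_per_Obj(2)[OF *(2)] realizer_per_Obj(2)[OF *(3)]
          realizer_per_Obj(2)[OF **(2)] realizes_equivariant[OF *(4,5)]
          realizes_equivariant[OF **(3,4)]]
      by (simp add: *(1) **(1) Comp_Mdst realizer_functor_def)
  qed
qed

lemma realizer_functor_fully_faithful:
  assumes P: "P \<in> Obj (Mdst small X le U)" and Q: "Q \<in> Obj (Mdst small X le U)"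
  shows "bij_betw (FArr realizer_functor) (hom (Mdst small X le U) P Q)
    (hom (PEqu small X le U) (FObj realizer_functor P) (FObj realizer_functor Q))"
proof (rule bij_betw_imageI)
  show "inj_on (FArr realizer_functor) (hom (Mdst small X le U) P Q)"
  proof (rule inj_onI)
    fix h h' assume "h \<in> hom (Mdst small X le U) P Q" "h' \<in> hom (Mdst small X le U) P Q"
      and eq: "FArr realizer_functor h = FArr realizer_functor h'"
    then obtain f f' g where h: "h = (P, f, Q)" "h' = (P, f', Q)"
      and f: "f \<in> fst P \<rightarrow>\<^sub>E fst Q" "f' \<in> fst P \<rightarrow>\<^sub>E fst Q" and g: "g \<in> realizer_set P Q f"
      by (auto simp: hom_Mdst)
    have "g \<in> realizer_set P Q f'" using eq g by (simp add: h realizer_functor_def)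
    then show "h = h'" using realizes_unique[OF P Q f(1) g f(2)] by (simp add: h)
  qed
  have "h \<in> FArr realizer_functor ` hom (Mdst small X le U) P Q"
    if h: "h \<in> hom (PEqu small X le U) (realizer_per P) (realizer_per Q)" for h
  proof -
    obtain g where h_eq: "h = (realizer_per P, pequ_rel X U (realizer_per P) (realizer_per Q) `` {g},
          realizer_per Q)" and g: "g \<in> equivariant X U (realizer_per P) (realizer_per Q)"
      using h by (rule hom_PEquE)
    obtain f where f: "f \<in> fst P \<rightarrow>\<^sub>E fst Q" "g \<in> realizer_set P Q f"
      using equivariant_realizes[OF P Q g] .
    have "(P, f, Q) \<in> hom (Mdst small X le U) P Q" using P Q f by (auto simp: hom_Mdst)
    moreover have "FArr realizer_functor (P, f, Q) = h"
      using realizer_set_eq_class[OF Q f] by (simp add: realizer_functor_def h_eq)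
    ultimately show ?thesis by force
  qed
  moreover have "FArr realizer_functor f \<in> hom (PEqu small X le U) (realizer_per P) (realizer_per Q)"
    if "f \<in> hom (Mdst small X le U) P Q" for f
    using is_functor_realizer_functor[of le] that
    unfolding is_functor_def FObj_realizer_functor by blast
  ultimately show "FArr realizer_functor ` hom (Mdst small X le U) P Q =
      hom (PEqu small X le U) (FObj realizer_functor P) (FObj realizer_functor Q)"
    unfolding FObj_realizer_functor by blast
qed

text \<open>The carrier of an assembly consists of individuals of type \<open>'u\<close>, so an equivalence class, of
  type \<open>'u set\<close>, cannot serve as its own name; a chosen representative does.\<close>

lemma realizer_functor_surj:
  assumes small_subset: "\<And>A B. small A \<Longrightarrow> B \<subseteq> A \<Longrightarrow> small B"
    and P: "P \<in> Obj (PEqu small X le U)"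
  obtains M where "M \<in> Obj (Mdst small X le U)" "realizer_per M = P"
proof -
  obtain Y r where P': "P = (Y, r)" by (cases P)
  have r: "r \<subseteq> FObj U Y \<times> FObj U Y" "sym r" "trans r" and Y: "Y \<in> Obj X" "injective small X le U Y"
    using P by (auto simp: P' Obj_PEqu is_per_def)
  define rep where "rep x = (SOME y. (x, y) \<in> r)" for x
  have rep: "(x, rep x) \<in> r" if "(x, y) \<in> r" for x y
    using that unfolding rep_def by (rule someI)
  have rep_cong: "rep x = rep y" if "(x, y) \<in> r" for x y
  proof -
    have "(x, z) \<in> r \<longleftrightarrow> (y, z) \<in> r" for z using that r(2,3) by (meson symD transD)
    then show ?thesis by (simp add: rep_def)
  qed
  define S where "S = rep ` Domain r"
  define E where "E = (\<lambda>a\<in>S. r `` {a})"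
  have S: "rep a = a" "(a, a) \<in> r" if a: "a \<in> S" for a
  proof -
    obtain x y where x: "(x, y) \<in> r" "a = rep x" using a by (auto simp: S_def)
    have xa: "(x, a) \<in> r" using rep x by blast
    then show "rep a = a" using rep_cong[OF xa] x(2) by metis
    show "(a, a) \<in> r" using xa r(2,3) by (meson symD transD)
  qed
  have "S \<subseteq> FObj U Y" using S(2) r(1) by blast
  then have "small S" using small_FObj[OF Y(1)] small_subset by blast
  then have "(S, Y, E) \<in> Obj (Assm small X le U)"
    using Y S r(1) by (auto simp: Obj_Assm E_def)
  moreover have "a = a'" if "a \<in> S" "a' \<in> S" "x \<in> E a" "x \<in> E a'" for a a' x
  proof -
    have "(a, x) \<in> r" "(a', x) \<in> r" using that by (auto simp: E_def)
    then have "rep a = rep x" "rep a' = rep x" by (blast dest: rep_cong)+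
    then show ?thesis using S(1) that by simp
  qed
  then have "modest (S, Y, E)" by (auto simp: modest_def)
  ultimately have "(S, Y, E) \<in> Obj (Mdst small X le U)" by (simp add: Obj_Mdst)
  moreover have "realizer_per (S, Y, E) = P"
  proof -
    have "(x, x') \<in> r \<longleftrightarrow> (\<exists>a\<in>S. x \<in> E a \<and> x' \<in> E a)" for x x'
    proof
      assume xx': "(x, x') \<in> r"
      then have "rep x \<in> S" "(rep x, x) \<in> r" using rep r(2) by (auto simp: S_def dest: symD)
      moreover have "(rep x, x') \<in> r" using calculation xx' r(3) by (meson transD)
      ultimately show "\<exists>a\<in>S. x \<in> E a \<and> x' \<in> E a" by (auto simp: E_def)
    next
      assume "\<exists>a\<in>S. x \<in> E a \<and> x' \<in> E a"
      then obtain a where "(a, x) \<in> r" "(a, x') \<in> r" by (auto simp: E_def)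
      then show "(x, x') \<in> r" using r(2,3) by (meson symD transD)
    qed
    then show ?thesis by (auto simp: realizer_per_def P')
  qed
  ultimately show thesis by (rule that)
qed

lemma PEqu_equivalent_Mdst:
  assumes small_subset: "\<And>A B. small A \<Longrightarrow> B \<subseteq> A \<Longrightarrow> small B"
  shows "equivalent_categories (PEqu small X le U) (Mdst small X le U)"
proof (rule fully_faithful_ess_surj_equivalence)
  let ?C = "PEqu small X le U"
  interpret C: category ?C by (rule category_PEqu)
  show "\<exists>M\<in>Obj (Mdst small X le U). \<exists>i\<in>hom ?C P (FObj realizer_functor M). is_iso ?C i"
    if P: "P \<in> Obj ?C" for P
  proof -
    obtain M where M: "M \<in> Obj (Mdst small X le U)" "realizer_per M = P"
      using realizer_functor_surj[OF small_subset P] .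
    have "Id ?C P \<in> hom ?C P P" by (rule C.id_hom[OF P])
    moreover have "is_iso ?C (Id ?C P)"
      using calculation C.id_comp by (blast intro: is_isoI)
    ultimately show ?thesis using M by (auto simp: realizer_functor_def)
  qed
qed (fact category_PEqu category_Mdst is_functor_realizer_functor
    realizer_functor_fully_faithful)+

end

theorem theorem1p4:
  fixes small :: "'u set \<Rightarrow> bool"
    and X :: "('o, 'm) cat"
    and U :: "('o, 'm, 'u set, 'u setmap) fctr"
    and L :: "('u set, 'u setmap, 'o, 'm) fctr"
    and le :: "'m \<Rightarrow> 'm \<Rightarrow> bool"
    and R :: "('o, 'm, 'o, 'm) fctr"
    and star :: 'u and One :: 'o
  assumes "set_universe small"
    and "category X"
    and "topological small X U"
    and "left_adjoint (SET small) X L U"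
    and "One = FObj L {star}"
    and a: "preorder_enriched X le"
    and b: "\<And>A B x x' f. \<lbrakk>x \<in> hom X One A; x' \<in> hom X One A; initial_morphism small X U A B f;
        equivalent_under le (f \<cdot>\<^bsub>X\<^esub> x) (f \<cdot>\<^bsub>X\<^esub> x')\<rbrakk> \<Longrightarrow> equivalent_under le x x'"
    and c: "enough_injectives small X le U"
    and d: "\<And>Z. injective small X le U Z \<Longrightarrow> exponentiable X Z"
    and "left_adjoint X (X_sep X le) R id_functor"
    and e: "preserves_finite_products X (X_sep X le) R"
  shows "equivalent_categories (PEqu small X le U) (Mdst small X le U)"
proof -
  interpret category X by fact
  interpret concrete_category X small U
    using \<open>topological small X U\<close> by unfold_locales (simp add: topological_def)
  show ?thesis
    using \<open>set_universe small\<close> by (intro PEqu_equivalent_Mdst) (auto simp: set_universe_def)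
qed

end
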